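(* Let $g(x)$ and $h(x)$ be two symmetric polynomials of the same degree $n\ge 1$ with complex coefficients. Then $g(x)$ and $h(x)$ have interlacing roots if and only if the Hermitian form $$\mathfrak{K}[g,h;x_0,x_1,\ldots,x_{n-1}]=\left[i\,\frac{g(x)\overline{h}(y)-\overline{g}(y)h(x)}{1-xy}\right]_n$$ is sign-definite (i.e. positive definite or negative definite).
   Context: For a polynomial $f$, $\overline{f}$ denotes the polynomial whose coefficients are the complex conjugates of those of $f$. A polynomial $g(x)=a_0+a_1x+\dots+a_nx^n$ of degree $n$ is called symmetric if $g(x)=x^n\overline{g}(1/x)$, i.e. $a_k=\overline{a}_{n-k}$ for all $k$ (in particular $a_0=\overline{a}_n\neq0$). For an expression $P(x,y)=\sum_{j,k}p_{jk}x^jy^k$ with $p_{kj}=\overline{p}_{jk}$, the symbol $[P(x,y)]_n$ denotes the Hermitian form $\sum_{j,k=0}^{n-1}p_{jk}x_j\overline{x}_k$ in complex variables $x_0,\dots,x_{n-1}$; in the form above $i$ is the imaginary unit, and the quotient is a polynomial in $x,y$ of degree at most $n-1$ in each variable. Two polynomials of degree $n$ have interlacing roots if all the roots of each are simple and lie on the circle $|x|=1$, and between any two consecutive roots (on the circle) of one polynomial, i.e. on the open arc joining them, there lies one and only one root of the other polynomial. (For $n=1$ the only arc is the circle with the single root removed, so the condition means that the two roots lie on the circle and are distinct.) *)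

theory Defs
  imports Complex_Main "HOL-Computational_Algebra.Polynomial"
begin

definition conj_poly :: "complex poly \<Rightarrow> complex poly" where
  "conj_poly f = map_poly cnj f"

(* reflect_poly p is x ^ degree p * p (1 / x). *)
definition symmetric_poly :: "complex poly \<Rightarrow> bool" where
  "symmetric_poly g \<longleftrightarrow> g = reflect_poly (conj_poly g)"

lemma degree_conj_poly [simp]: "degree (conj_poly f) = degree f"
  unfolding conj_poly_def by (rule degree_map_poly) simp

lemma coeff_conj_poly [simp]: "coeff (conj_poly f) k = cnj (coeff f k)"
  unfolding conj_poly_def by (simp add: coeff_map_poly)

lemma symmetric_poly_iff_coeff:
  "symmetric_poly g \<longleftrightarrow> (\<forall>k\<le>degree g. coeff g k = cnj (coeff g (degree g - k)))"
  by (auto simp: symmetric_poly_def poly_eq_iff coeff_reflect_poly not_less coeff_eq_0)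

(* Bivariate polynomials are elements of (C[x])[y]: the coefficient of x^j y^k in P is
   coeff (coeff P k) j. *)
definition in_x :: "complex poly \<Rightarrow> complex poly poly" where
  "in_x f = [:f:]"

definition in_y :: "complex poly \<Rightarrow> complex poly poly" where
  "in_y f = map_poly (\<lambda>c. [:c:]) f"

definition var_x :: "complex poly poly" where
  "var_x = in_x [:0, 1:]"

definition var_y :: "complex poly poly" where
  "var_y = in_y [:0, 1:]"

definition krein_numerator :: "complex poly \<Rightarrow> complex poly \<Rightarrow> complex poly poly" where
  "krein_numerator g h =
     in_x [:\<i>:] * (in_x g * in_y (conj_poly h) - in_y (conj_poly g) * in_x h)"

(* Division in (C[x])[y]; it is exact for symmetric polynomials of equal degree,
   see krein_quotient_exact. *)
definition krein_quotient :: "complex poly \<Rightarrow> complex poly \<Rightarrow> complex poly poly" where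
  "krein_quotient g h = krein_numerator g h div (1 - var_x * var_y)"

definition hermitian_form :: "nat \<Rightarrow> complex poly poly \<Rightarrow> (nat \<Rightarrow> complex) \<Rightarrow> complex" where
  "hermitian_form n P v = (\<Sum>j<n. \<Sum>k<n. coeff (coeff P k) j * v j * cnj (v k))"

(* Only the values of v below n matter, so "nonzero vector" refers to those. *)
definition pos_definite :: "nat \<Rightarrow> ((nat \<Rightarrow> complex) \<Rightarrow> complex) \<Rightarrow> bool" where
  "pos_definite n F \<longleftrightarrow> (\<forall>v. (\<exists>j<n. v j \<noteq> 0) \<longrightarrow> F v \<in> \<real> \<and> Re (F v) > 0)"

definition neg_definite :: "nat \<Rightarrow> ((nat \<Rightarrow> complex) \<Rightarrow> complex) \<Rightarrow> bool" where
  "neg_definite n F \<longleftrightarrow> (\<forall>v. (\<exists>j<n. v j \<noteq> 0) \<longrightarrow> F v \<in> \<real> \<and> Re (F v) < 0)"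

definition sign_definite :: "nat \<Rightarrow> ((nat \<Rightarrow> complex) \<Rightarrow> complex) \<Rightarrow> bool" where
  "sign_definite n F \<longleftrightarrow> pos_definite n F \<or> neg_definite n F"

definition simple_unit_roots :: "complex poly \<Rightarrow> bool" where
  "simple_unit_roots f \<longleftrightarrow> (\<forall>z. poly f z = 0 \<longrightarrow> order z f = 1 \<and> norm z = 1)"

(* The open arc traversed counterclockwise from cis s to cis t. *)
definition open_arc :: "real \<Rightarrow> real \<Rightarrow> complex set" where
  "open_arc s t = cis ` {s<..<t}"

(* s and t are arguments (taken in R, not modulo 2 pi) of consecutive roots.  If f has a single
   root on the circle, then t = s + 2 pi and the arc is the circle without that root. *)
definition consecutive_roots :: "complex poly \<Rightarrow> real \<Rightarrow> real \<Rightarrow> bool" where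
  "consecutive_roots f s t \<longleftrightarrow>
     s < t \<and> poly f (cis s) = 0 \<and> poly f (cis t) = 0 \<and> (\<forall>z\<in>open_arc s t. poly f z \<noteq> 0)"

definition roots_separated_by :: "complex poly \<Rightarrow> complex poly \<Rightarrow> bool" where
  "roots_separated_by f q \<longleftrightarrow>
     (\<forall>s t. consecutive_roots f s t \<longrightarrow> (\<exists>!z. z \<in> open_arc s t \<and> poly q z = 0))"

definition interlacing_roots :: "complex poly \<Rightarrow> complex poly \<Rightarrow> bool" where
  "interlacing_roots g h \<longleftrightarrow>
     simple_unit_roots g \<and> simple_unit_roots h \<and>
     roots_separated_by g h \<and> roots_separated_by h g"

lemma in_x_expand:
  assumes "degree f = n"
  shows "in_x f = (\<Sum>j\<le>n. in_x [:coeff f j:] * var_x ^ j)"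
proof -
  have 1: "in_x [:c:] * var_x ^ j = [:monom c j:]" for c j
    by (induction j)
       (simp_all add: in_x_def var_x_def monom_0 monom_Suc mult.left_commute[of _ "[:[:0,1:]:]"])
  have "[:\<Sum>j\<in>A. F j:] = (\<Sum>j\<in>A. [:F j:])" if "finite A" for A :: "nat set" and F :: "nat \<Rightarrow> complex poly"
    using that
  proof (induction A)
    case (insert a A)
    then show ?case by (metis add_0 add_pCons sum.insert)
  qed simp
  then have "(\<Sum>j\<le>n. [:monom (coeff f j) j:]) = [:\<Sum>j\<le>n. monom (coeff f j) j:]"
    by simp
  also have "(\<Sum>j\<le>n. monom (coeff f j) j) = f"
    using poly_as_sum_of_monoms[of f] assms by simp
  finally show ?thesis
    by (simp only: 1) (simp only: in_x_def)
qed

lemma in_y_expand: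
  assumes "degree f = n"
  shows "in_y f = (\<Sum>j\<le>n. in_x [:coeff f j:] * var_y ^ j)"
proof -
  have y: "var_y = monom 1 1"
    by (simp add: var_y_def in_y_def map_poly_pCons monom_Suc monom_0 one_pCons)
  have 1: "in_x [:c:] * var_y ^ j = monom [:c:] j" for c j
    by (simp add: y in_x_def monom_power smult_monom)
  show ?thesis
    unfolding 1 using assms
    by (intro poly_eqI) (auto simp: in_y_def coeff_map_poly coeff_sum coeff_eq_0 sum.delta)
qed

lemma dvd_monomial_diff:
  fixes x y :: "'a :: comm_ring_1"
  assumes "j \<le> n" "k \<le> n"
  shows "1 - x * y dvd x ^ j * y ^ (n - k) - x ^ k * y ^ (n - j)"
proof -
  have *: "1 - x * y dvd x ^ j * y ^ (n - k) - x ^ k * y ^ (n - j)" if "k \<le> j" "j \<le> n" for j k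
  proof -
    have "x ^ j = x ^ k * x ^ (j - k)" "y ^ (n - k) = y ^ (n - j) * y ^ (j - k)"
      using that by (simp_all flip: power_add)
    then have "x ^ j * y ^ (n - k) - x ^ k * y ^ (n - j) = x ^ k * y ^ (n - j) * ((x * y) ^ (j - k) - 1)"
      by (simp add: algebra_simps power_mult_distrib)
    moreover have "1 - x * y dvd 1 - (x * y) ^ (j - k)"
      by (metis one_diff_power_eq dvd_triv_left)
    ultimately show ?thesis
      by (metis dvd_mult dvd_minus_iff minus_diff_eq)
  qed
  show ?thesis
    using *[of k j] *[of j k] assms by (metis dvd_minus_iff minus_diff_eq nle_le)
qed

lemma krein_quotient_exact:
  assumes "symmetric_poly g" "symmetric_poly h" "degree g = n" "degree h = n"
  shows "(1 - var_x * var_y) * krein_quotient g h = krein_numerator g h"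
proof -
  let ?c = "\<lambda>f j. in_x [:coeff f j:]"
  have y: "in_y (conj_poly f) = (\<Sum>k\<le>n. ?c f k * var_y ^ (n - k))"
    if "symmetric_poly f" "degree f = n" for f
  proof -
    have "in_y (conj_poly f) = (\<Sum>k\<le>n. in_x [:cnj (coeff f k):] * var_y ^ k)"
      using that(2) by (subst in_y_expand[of _ n]) auto
    also have "\<dots> = (\<Sum>k\<le>n. in_x [:cnj (coeff f (n - k)):] * var_y ^ (n - k))"
      by (rule sum.reindex_bij_witness[of _ "\<lambda>k. n - k" "\<lambda>k. n - k"]) auto
    also have "\<dots> = (\<Sum>k\<le>n. ?c f k * var_y ^ (n - k))"
      using that unfolding symmetric_poly_iff_coeff by (intro sum.cong refl) (metis atMost_iff)
    finally show ?thesis .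
  qed
  have "in_x g * in_y (conj_poly h) - in_y (conj_poly g) * in_x h =
      (\<Sum>j\<le>n. \<Sum>k\<le>n. ?c g j * var_x ^ j * (?c h k * var_y ^ (n - k)))
      - (\<Sum>j\<le>n. \<Sum>k\<le>n. ?c g j * var_y ^ (n - j) * (?c h k * var_x ^ k))"
    unfolding y[OF assms(1,3)] y[OF assms(2,4)] in_x_expand[OF assms(3)] in_x_expand[OF assms(4)]
      sum_product ..
  also have "\<dots> = (\<Sum>j\<le>n. \<Sum>k\<le>n. ?c g j * ?c h k *
      (var_x ^ j * var_y ^ (n - k) - var_x ^ k * var_y ^ (n - j)))"
    unfolding sum_subtractf[symmetric] right_diff_distrib
    by (intro sum.cong refl) (simp only: ac_simps)
  finally have "1 - var_x * var_y dvd in_x g * in_y (conj_poly h) - in_y (conj_poly g) * in_x h"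
    by (auto intro!: dvd_sum dvd_mult dvd_monomial_diff)
  then show ?thesis
    unfolding krein_quotient_def krein_numerator_def by (simp only: dvd_mult dvd_mult_div_cancel)
qed

end

theory Submission
  imports Defs "HOL-Analysis.Analysis" "HOL-Computational_Algebra.Fundamental_Theorem_Algebra"
begin

text \<open>With \<open>z = cis \<theta>\<close>, \<open>g z = cis (n \<theta> / 2) * \<gamma> \<theta>\<close> and \<open>h z = cis (n \<theta> / 2) * \<eta> \<theta>\<close> for real functions
  \<open>\<gamma>\<close> and \<open>\<eta>\<close>. On the vector \<open>(1, z, \<dots>, z\<^sup>n\<^sup>-\<^sup>1)\<close> the form takes the value of the quotient at
  \<open>x = z\<close>, \<open>y = cnj z\<close>. If \<open>g z = 0\<close> this is \<open>0\<close> when \<open>\<bar>z\<bar> \<noteq> 1\<close> and \<open>- \<gamma>' \<theta> * \<eta> \<theta>\<close> when \<open>z = cis \<theta>\<close>.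
  Hence for a definite form the roots of \<open>g\<close> are simple and on the circle, and \<open>\<gamma>' * \<eta>\<close> has a constant
  sign at them; as \<open>\<gamma>'\<close> alternates in sign from root to root, so does \<open>\<eta>\<close>, which therefore vanishes in
  between. The same holds with \<open>g\<close> and \<open>h\<close> exchanged, so that a gap of \<open>g\<close> cannot contain two roots of
  \<open>h\<close>. Conversely, if the \<open>n\<close> roots of \<open>g\<close> are simple and on the circle, the corresponding vectors form
  an orthogonal basis for the form, and interlacing makes the diagonal entries \<open>- \<gamma>' * \<eta>\<close> of one sign.\<close>

section \<open>Alternation of the zeros of two real functions\<close>

text \<open>Just to the right of \<open>s\<close> the function \<open>d * f\<close> is positive, as
  its derivative at \<open>s\<close> is \<open>d * d\<close>; another sign at \<open>x\<close> would
  force a zero in between.\<close>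

lemma sign_right_of_simple_zero:
  fixes f :: "real \<Rightarrow> real"
  assumes cont: "\<And>x. isCont f x" and der: "DERIV f s :> d" and "d \<noteq> 0" "f s = 0" "s < x"
    and nz: "\<And>y. s < y \<Longrightarrow> y \<le> x \<Longrightarrow> f y \<noteq> 0"
  shows "d * f x > 0"
proof (rule ccontr)
  assume neg: "\<not> d * f x > 0"
  have "DERIV (\<lambda>x. d * f x) s :> d * d"
    using der by (auto intro!: derivative_eq_intros)
  moreover have "d * d > 0"
    using \<open>d \<noteq> 0\<close> by (auto simp: zero_less_mult_iff)
  ultimately obtain e where e: "e > 0" "\<And>h. 0 < h \<Longrightarrow> h < e \<Longrightarrow> d * f s < d * f (s + h)"
    using DERIV_pos_inc_right by blast
  define h where "h = min (e / 2) (x - s)"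
  have h: "h > 0" "h < e" "s + h \<le> x"
    using e(1) \<open>s < x\<close> by (auto simp: h_def)
  have "\<exists>z. s + h \<le> z \<and> z \<le> x \<and> d * f z = 0"
  proof (rule IVT2)
    show "d * f x \<le> 0" using neg by simp
    show "0 \<le> d * f (s + h)" using e(2)[of h] h \<open>f s = 0\<close> by simp
    show "\<forall>y. s + h \<le> y \<and> y \<le> x \<longrightarrow> isCont (\<lambda>x. d * f x) y"
      using cont by (auto intro!: continuous_intros)
  qed (use h in auto)
  with nz h \<open>d \<noteq> 0\<close> show False by force
qed

lemma sign_left_of_simple_zero:
  fixes f :: "real \<Rightarrow> real"
  assumes cont: "\<And>x. isCont f x" and der: "DERIV f t :> d" and "d \<noteq> 0" "f t = 0" "x < t"
    and nz: "\<And>y. x \<le> y \<Longrightarrow> y < t \<Longrightarrow> f y \<noteq> 0"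
  shows "d * f x < 0"
proof -
  have "- d * f (- (- x)) > 0"
  proof (rule sign_right_of_simple_zero[where f = "\<lambda>x. f (- x)" and s = "- t"])
    show "isCont (\<lambda>x. f (- x)) y" for y
      using isCont_o2[where f = uminus and g = f] cont by simp
    show "((\<lambda>x. f (- x)) has_field_derivative - d) (at (- t))"
      using DERIV_mirror[where f = f and x = "- t" and y = d] der by simp
    show "f (- y) \<noteq> 0" if "- t < y" "y \<le> - x" for y
      using nz[of "- y"] that by simp
  qed (use assms in auto)
  then show ?thesis by simp
qed

definition consecutive_zeros :: "(real \<Rightarrow> real) \<Rightarrow> real \<Rightarrow> real \<Rightarrow> bool" where
  "consecutive_zeros f s t \<longleftrightarrow> s < t \<and> f s = 0 \<and> f t = 0 \<and> (\<forall>x\<in>{s<..<t}. f x \<noteq> 0)"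

text \<open>Existence alone is required; uniqueness follows when two functions separate each other's
  simple zeros, see \<open>unique_zero_between\<close>.\<close>

definition separates_zeros :: "(real \<Rightarrow> real) \<Rightarrow> (real \<Rightarrow> real) \<Rightarrow> bool" where
  "separates_zeros q f \<longleftrightarrow> (\<forall>s t. consecutive_zeros f s t \<longrightarrow> (\<exists>x\<in>{s<..<t}. q x = 0))"

text \<open>A simple zero is isolated on its right, so the later zeros up to \<open>t\<close> form a
  nonempty compact set, whose least element is the next zero.\<close>

lemma obtain_next_zero:
  fixes f :: "real \<Rightarrow> real"
  assumes cont: "\<And>x. isCont f x" and der: "DERIV f s :> d" and "d \<noteq> 0" "f s = 0"
    and "s < t" "f t = 0"
  obtains u where "u \<le> t" "consecutive_zeros f s u"
proof -
  have "\<exists>e>0. \<forall>h>0. h < e \<longrightarrow> f (s + h) \<noteq> 0"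
  proof (cases "d > 0")
    case True
    with DERIV_pos_inc_right[OF der True] \<open>f s = 0\<close> show ?thesis by force
  next
    case False
    with \<open>d \<noteq> 0\<close> have "d < 0" by simp
    with DERIV_neg_dec_right[OF der] \<open>f s = 0\<close> show ?thesis by force
  qed
  then obtain e where e: "e > 0" "\<And>h. 0 < h \<Longrightarrow> h < e \<Longrightarrow> f (s + h) \<noteq> 0" by blast
  have near: "f y \<noteq> 0" if "s < y" "y < s + e" for y
    using e(2)[of "y - s"] that by simp
  define A where "A = {x \<in> {s + e..t}. f x = 0}"
  have "t \<in> A"
    using near[of t] assms by (force simp: A_def)
  have "closed A"
    unfolding A_def using cont
    by (intro continuous_closed_preimage_constant) (auto intro: continuous_at_imp_continuous_on)
  have "bdd_below A"
    by (rule bdd_belowI[of _ "s + e"]) (auto simp: A_def)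
  then have "Inf A \<in> A"
    using closed_contains_Inf \<open>closed A\<close> \<open>t \<in> A\<close> by blast
  have "f y \<noteq> 0" if "s < y" "y < Inf A" for y
  proof
    assume "f y = 0"
    with near that(1) have "s + e \<le> y" by force
    with \<open>f y = 0\<close> that(2) \<open>Inf A \<in> A\<close> have "y \<in> A" by (auto simp: A_def)
    with \<open>bdd_below A\<close> that(2) show False by (meson cInf_lower not_le)
  qed
  with \<open>Inf A \<in> A\<close> e(1) \<open>f s = 0\<close> have "consecutive_zeros f s (Inf A)"
    by (auto simp: consecutive_zeros_def A_def)
  moreover have "Inf A \<le> t" using \<open>Inf A \<in> A\<close> by (simp add: A_def)
  ultimately show ?thesis using that by blast
qed

text \<open>The value at the midpoint has the sign of \<open>d\<close>, seen from \<open>s\<close>,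
  and the sign opposite to \<open>e\<close>, seen from \<open>t\<close>.\<close>

lemma consecutive_zeros_derivatives:
  fixes f :: "real \<Rightarrow> real"
  assumes cont: "\<And>x. isCont f x" and con: "consecutive_zeros f s t"
    and "DERIV f s :> d" "d \<noteq> 0" "DERIV f t :> e" "e \<noteq> 0"
  shows "d * e < 0"
proof -
  define m where "m = (s + t) / 2"
  have m: "s < m" "m < t" and nz: "\<And>x. s < x \<Longrightarrow> x < t \<Longrightarrow> f x \<noteq> 0"
    and [simp]: "f s = 0" "f t = 0"
    using con by (auto simp: m_def consecutive_zeros_def)
  have "d * f m > 0"
    by (rule sign_right_of_simple_zero[OF cont assms(3,4)]) (use m nz in auto)
  moreover have "e * f m < 0"
    by (rule sign_left_of_simple_zero[OF cont assms(5,6)]) (use m nz in auto)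
  ultimately show ?thesis
    by (auto simp: zero_less_mult_iff mult_less_0_iff)
qed

text \<open>The derivative changes sign from one zero to the next while \<open>f' * q\<close> does
  not, so \<open>q\<close> changes sign and vanishes in between. The factor \<open>c\<close> covers
  both signs of the product.\<close>

lemma separates_zeros_if_constant_sign:
  fixes f q :: "real \<Rightarrow> real"
  assumes contf: "\<And>x. isCont f x" and contq: "\<And>x. isCont q x"
    and der: "\<And>s. f s = 0 \<Longrightarrow> DERIV f s :> f' s"
    and sgn: "\<And>s. f s = 0 \<Longrightarrow> c * (f' s * q s) > 0"
  shows "separates_zeros q f"
  unfolding separates_zeros_def
proof (intro allI impI)
  fix s t assume con: "consecutive_zeros f s t"
  then have st: "s < t" "f s = 0" "f t = 0" by (auto simp: consecutive_zeros_def)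
  then have "f' s * f' t < 0"
    using consecutive_zeros_derivatives[OF contf con der _ der] sgn by force
  with sgn[OF st(2)] sgn[OF st(3)] have sign: "q s * q t < 0"
    by (auto simp: zero_less_mult_iff mult_less_0_iff)
  have "\<exists>x\<ge>s. x \<le> t \<and> q x = 0"
  proof (cases "q s < 0")
    case True
    with sign have "q t > 0" by (auto simp: mult_less_0_iff)
    with True st contq IVT[of q s 0 t] show ?thesis by auto
  next
    case False
    with sign have "q s > 0" "q t < 0" by (auto simp: mult_less_0_iff)
    with st contq IVT2[of q t 0 s] show ?thesis by auto
  qed
  then obtain x where x: "s \<le> x" "x \<le> t" "q x = 0" by blast
  moreover have "x \<noteq> s" "x \<noteq> t" using sign x by auto
  ultimately show "\<exists>x\<in>{s<..<t}. q x = 0" by force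
qed

locale mutually_separating =
  fixes f q f' q' :: "real \<Rightarrow> real"
  assumes contf: "isCont f x" and contq: "isCont q x"
    and derf: "f x = 0 \<Longrightarrow> DERIV f x :> f' x" and f'_nz: "f x = 0 \<Longrightarrow> f' x \<noteq> 0"
    and derq: "q x = 0 \<Longrightarrow> DERIV q x :> q' x" and q'_nz: "q x = 0 \<Longrightarrow> q' x \<noteq> 0"
    and sep_qf: "separates_zeros q f" and sep_fq: "separates_zeros f q"
begin

text \<open>For two zeros of \<open>q\<close> in one gap of \<open>f\<close>, the gap of
  \<open>q\<close> starting at the first would contain a zero of \<open>f\<close>.\<close>

lemma unique_zero_between:
  assumes con: "consecutive_zeros f s t" and "q u = 0" "q v = 0" "u \<in> {s<..<t}" "v \<in> {s<..<t}"
  shows "u = v"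
proof -
  have False if uv: "u < v" "q u = 0" "q v = 0" "u \<in> {s<..<t}" "v \<in> {s<..<t}" for u v
  proof -
    obtain w where w: "w \<le> v" "consecutive_zeros q u w"
      using obtain_next_zero[OF contq derq q'_nz] uv by metis
    then obtain x where "x \<in> {u<..<w}" "f x = 0"
      using sep_fq unfolding separates_zeros_def by blast
    with uv w con show False by (auto simp: consecutive_zeros_def)
  qed
  from this[of u v] this[of v u] assms show ?thesis by force
qed

text \<open>The gap of \<open>f\<close> starting at a common zero \<open>s\<close> contains a zero
  of \<open>q\<close>. Hence the gap of \<open>q\<close> starting at \<open>s\<close> ends earlier,
  and yet it must contain a zero of \<open>f\<close>.\<close>

lemma no_common_zero:
  assumes "f s = 0" "f t = 0" "q t' = 0" "s < t" "s < t'"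
  shows "q s \<noteq> 0"
proof
  assume "q s = 0"
  obtain u where u: "consecutive_zeros f s u"
    using obtain_next_zero[OF contf derf f'_nz] assms by metis
  then obtain x where x: "x \<in> {s<..<u}" "q x = 0"
    using sep_qf unfolding separates_zeros_def by blast
  then obtain v where v: "v \<le> x" "consecutive_zeros q s v"
    using obtain_next_zero[OF contq derq q'_nz] \<open>q s = 0\<close> by (metis greaterThanLessThan_iff)
  then obtain y where "y \<in> {s<..<v}" "f y = 0"
    using sep_fq unfolding separates_zeros_def by blast
  with u v x show False by (auto simp: consecutive_zeros_def)
qed

text \<open>Exactly one zero of \<open>q\<close> lies in the gap, and being simple it changes the
  sign of \<open>q\<close>; \<open>f'\<close> changes sign as well, so the product does not.\<close>

lemma consecutive_same_sign:
  assumes con: "consecutive_zeros f s t" and "q s \<noteq> 0" "q t \<noteq> 0"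
  shows "(f' s * q s) * (f' t * q t) > 0"
proof -
  have st: "s < t" "f s = 0" "f t = 0" using con by (auto simp: consecutive_zeros_def)
  obtain u where u: "u \<in> {s<..<t}" "q u = 0"
    using sep_qf con unfolding separates_zeros_def by blast
  have nz: "q x \<noteq> 0" if "x \<in> {s..t}" "x \<noteq> u" for x
    using unique_zero_between[OF con _ u(2) _ u(1), of x] that assms
    by (cases "x = s \<or> x = t") auto
  have "q' u * q t > 0"
    by (rule sign_right_of_simple_zero[OF contq derq q'_nz]) (use u nz in auto)
  moreover have "q' u * q s < 0"
    by (rule sign_left_of_simple_zero[OF contq derq q'_nz]) (use u nz in auto)
  moreover have "f' s * f' t < 0"
    using consecutive_zeros_derivatives[OF contf con] derf f'_nz st by blast
  ultimately show ?thesis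
    by (auto simp: zero_less_mult_iff mult_less_0_iff)
qed

text \<open>The zeros up to \<open>t\<close> at which \<open>W\<close> has the sign of \<open>W s\<close> have a largest element by continuity
  of \<open>W\<close>; if it were below \<open>t\<close>, the next zero would also belong to this set.\<close>

lemma constant_sign:
  assumes W: "\<And>x. isCont W x" "\<And>x. f x = 0 \<Longrightarrow> W x = f' x * q x"
    and common: "\<And>x. f x = 0 \<Longrightarrow> q x \<noteq> 0"
    and st: "f s = 0" "f t = 0"
  shows "W s * W t > 0"
proof -
  have W_nz: "W x \<noteq> 0" if "f x = 0" for x
    using W(2) common f'_nz that by simp
  have *: "W s * W t > 0" if st: "f s = 0" "f t = 0" "s < t" for s t
  proof -
    define A where "A = {x \<in> {s..t}. f x = 0} \<inter> {x \<in> {s..t}. W s * W x \<ge> 0}"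
    have "closed A"
      unfolding A_def using contf W(1)
      by (intro closed_Int continuous_closed_preimage_constant continuous_closed_preimage
            closed_Collect_le continuous_on_closed_Collect_le)
         (auto intro!: continuous_intros continuous_at_imp_continuous_on)
    have "s \<in> A" using st by (simp add: A_def)
    have bdd: "bdd_above A" by (rule bdd_aboveI[of _ t]) (auto simp: A_def)
    have m: "Sup A \<in> A"
      using closed_contains_Sup[OF _ bdd \<open>closed A\<close>] \<open>s \<in> A\<close> by blast
    have "Sup A = t"
    proof (rule ccontr)
      assume "Sup A \<noteq> t"
      with m have lt: "Sup A < t" and f0: "f (Sup A) = 0" by (auto simp: A_def)
      then obtain u where u: "u \<le> t" "consecutive_zeros f (Sup A) u"
        using obtain_next_zero[OF contf derf f'_nz] st by metis
      then have u': "f u = 0" "Sup A < u" by (auto simp: consecutive_zeros_def)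
      have "W (Sup A) * W u > 0"
        using consecutive_same_sign[OF u(2)] common W(2) f0 u' by simp
      moreover have "W s * W (Sup A) \<ge> 0" using m by (simp add: A_def)
      ultimately have "W s * W u \<ge> 0"
        by (auto simp: zero_less_mult_iff zero_le_mult_iff)
      with u u' m have "u \<in> A" by (auto simp: A_def)
      with bdd u' show False by (meson cSup_upper not_le)
    qed
    \<comment> \<open>The sign condition in \<open>A\<close> is non-strict so that \<open>A\<close>
      is closed; strictness returns because \<open>W\<close> does not vanish at zeros of
      \<open>f\<close>.\<close>
    with m have "W s * W t \<ge> 0" by (simp add: A_def)
    with W_nz[OF st(1)] W_nz[OF st(2)] show ?thesis by (simp add: less_le)
  qed
  consider "s < t" | "s = t" | "t < s" by linarith
  then show ?thesis
  proof cases
    case 2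
    with W_nz[OF st(1)] show ?thesis by (auto simp: zero_less_mult_iff)
  qed (use *[of s t] *[of t s] st in \<open>simp_all add: mult.commute\<close>)
qed

end

section \<open>Symmetric polynomials on the unit circle\<close>

lemma poly_conj_poly: "poly (conj_poly f) z = cnj (poly f (cnj z))"
  by (simp add: conj_poly_def)

lemma poly_symmetric:
  assumes "symmetric_poly f" "z \<noteq> 0"
  shows "poly f z = z ^ degree f * cnj (poly f (1 / cnj z))"
proof -
  have "poly f z = poly (reflect_poly (conj_poly f)) z"
    using assms(1) by (metis symmetric_poly_def)
  also have "\<dots> = z ^ degree f * cnj (poly f (1 / cnj z))"
    using assms(2) by (simp add: poly_reflect_poly_nz poly_conj_poly inverse_eq_divide)
  finally show ?thesis .
qed

text \<open>By symmetry the number under \<open>Re\<close> is already real.\<close>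

definition circle_fun :: "complex poly \<Rightarrow> real \<Rightarrow> real" where
  "circle_fun f \<theta> = Re (cis (- (real (degree f) * \<theta> / 2)) * poly f (cis \<theta>))"

text \<open>Product rule at a zero of \<open>f\<close>: the term that differentiates the half-angle
  factor contains \<open>poly f (cis \<theta>)\<close> and is left out.\<close>

definition circle_deriv :: "complex poly \<Rightarrow> real \<Rightarrow> real" where
  "circle_deriv f \<theta> =
     Re (cis (- (real (degree f) * \<theta> / 2)) * (\<i> * cis \<theta> * poly (pderiv f) (cis \<theta>)))"

text \<open>On the circle symmetry reads \<open>f z = z ^ n * cnj (f z)\<close>; turning back by
  half the angle of \<open>z ^ n\<close> makes the value equal to its conjugate.\<close>

lemma of_real_circle_fun:
  assumes "symmetric_poly f"
  shows "complex_of_real (circle_fun f \<theta>) = cis (- (real (degree f) * \<theta> / 2)) * poly f (cis \<theta>)"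
proof -
  let ?c = "cis (- (real (degree f) * \<theta> / 2))"
  have "poly f (cis \<theta>) = cis \<theta> ^ degree f * cnj (poly f (cis \<theta>))"
    using poly_symmetric[OF assms, of "cis \<theta>"] by (simp add: cis_cnj cis_divide flip: cis_inverse inverse_eq_divide)
  then have "?c * poly f (cis \<theta>) = ?c * cis \<theta> ^ degree f * cnj (poly f (cis \<theta>))"
    by (simp only: mult.assoc)
  also have "?c * cis \<theta> ^ degree f = cnj ?c"
    by (simp add: Complex.DeMoivre cis_mult cis_cnj mult.commute)
  finally have "cnj (?c * poly f (cis \<theta>)) = ?c * poly f (cis \<theta>)"
    by simp
  then have "?c * poly f (cis \<theta>) \<in> \<real>"
    by (simp only: Reals_cnj_iff)
  then show ?thesis
    unfolding circle_fun_def by (simp only: of_real_Re)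
qed

lemma circle_fun_eq_0_iff:
  assumes "symmetric_poly f"
  shows "circle_fun f \<theta> = 0 \<longleftrightarrow> poly f (cis \<theta>) = 0"
  using of_real_circle_fun[OF assms, of \<theta>] by (metis cis_neq_zero mult_eq_0_iff of_real_eq_0_iff)

lemma isCont_circle_fun: "isCont (circle_fun f) \<theta>"
proof -
  have "continuous_on UNIV (circle_fun f)"
    unfolding circle_fun_def by (intro continuous_intros) auto
  then show ?thesis by (simp add: continuous_on_eq_continuous_at)
qed

lemma circle_fun_derivatives:
  assumes "symmetric_poly f" "poly f (cis s) = 0"
  shows "DERIV (circle_fun f) s :> circle_deriv f s"
    and "complex_of_real (circle_deriv f s) =
      cis (- (real (degree f) * s / 2)) * (\<i> * cis s * poly (pderiv f) (cis s))"
proof -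
  let ?D = "cis (- (real (degree f) * s / 2)) * (\<i> * cis s * poly (pderiv f) (cis s))"
  have cis: "((\<lambda>\<theta>. cis (c * \<theta>)) has_vector_derivative c *\<^sub>R (\<i> * cis (c * s))) (at s)" for c
    unfolding has_vector_derivative_def by (auto intro!: derivative_eq_intros)
  have "((poly f \<circ> cis) has_vector_derivative (\<i> * cis s) * poly (pderiv f) (cis s)) (at s)"
    using field_vector_diff_chain_at[of cis "\<i> * cis s" s "poly f"] cis[of 1] poly_DERIV by simp
  from has_vector_derivative_mult[OF cis[of "- (real (degree f) / 2)"] this]
  have "((\<lambda>\<theta>. complex_of_real (circle_fun f \<theta>)) has_vector_derivative ?D) (at s)"
    using assms by (simp add: of_real_circle_fun)
  \<comment> \<open>The function is real-valued: the real part of \<open>?D\<close> is its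
    derivative, and the imaginary part is the derivative of zero.\<close>
  from bounded_linear.has_vector_derivative[OF bounded_linear_Re this]
    bounded_linear.has_vector_derivative[OF bounded_linear_Im this]
  have re: "(circle_fun f has_vector_derivative Re ?D) (at s)"
    and im: "((\<lambda>\<theta>. 0) has_vector_derivative Im ?D) (at s)"
    by (simp_all only: Re_complex_of_real Im_complex_of_real)
  from re show "DERIV (circle_fun f) s :> circle_deriv f s"
    by (simp add: circle_deriv_def has_real_derivative_iff_has_vector_derivative)
  from im have "Im ?D = 0"
    using vector_derivative_unique_at has_vector_derivative_const by blast
  then show "complex_of_real (circle_deriv f s) = ?D"
    by (simp only: circle_deriv_def complex_eq_iff Re_complex_of_real Im_complex_of_real)
qed

lemma circle_deriv_nonzero:
  assumes "symmetric_poly f" "poly f (cis s) = 0" "poly (pderiv f) (cis s) \<noteq> 0"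
  shows "circle_deriv f s \<noteq> 0"
  using circle_fun_derivatives(2)[OF assms(1,2)] assms(3)
  by (metis cis_neq_zero complex_i_not_zero mult_eq_0_iff of_real_0)

lemma simple_unit_roots_iff:
  assumes "f \<noteq> 0"
  shows "simple_unit_roots f \<longleftrightarrow> (\<forall>z. poly f z = 0 \<longrightarrow> poly (pderiv f) z \<noteq> 0 \<and> norm z = 1)"
proof -
  have "order z f = 1 \<longleftrightarrow> poly (pderiv f) z \<noteq> 0" if "poly f z = 0" for z
  proof (cases "pderiv f = 0")
    case True
    then obtain c where "f = [:c:]" using pderiv_iszero by blast
    with that assms show ?thesis by simp
  next
    case False
    have "order z f = Suc (order z (pderiv f))"
      using assms that by (rule order_pderiv)
    with False show ?thesis by (simp add: order_root)
  qed
  then show ?thesis by (auto simp: simple_unit_roots_def)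
qed

lemma consecutive_roots_iff:
  assumes "symmetric_poly f"
  shows "consecutive_roots f s t \<longleftrightarrow> consecutive_zeros (circle_fun f) s t"
  using assms by (auto simp: consecutive_roots_def consecutive_zeros_def open_arc_def circle_fun_eq_0_iff)

lemma roots_separated_imp_separates_zeros:
  assumes "symmetric_poly f" "symmetric_poly q" "roots_separated_by f q"
  shows "separates_zeros (circle_fun q) (circle_fun f)"
  unfolding separates_zeros_def
proof (intro allI impI)
  fix s t assume "consecutive_zeros (circle_fun f) s t"
  then obtain z where "z \<in> open_arc s t" "poly q z = 0"
    using assms unfolding roots_separated_by_def consecutive_roots_iff[OF assms(1)] by metis
  then show "\<exists>x\<in>{s<..<t}. circle_fun q x = 0"
    using circle_fun_eq_0_iff[OF assms(2)] by (auto simp: open_arc_def)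
qed

lemma mutually_separating_circle_fun:
  assumes "symmetric_poly f" "symmetric_poly q" "simple_unit_roots f" "simple_unit_roots q"
    and "f \<noteq> 0" "q \<noteq> 0"
    and "separates_zeros (circle_fun q) (circle_fun f)"
    and "separates_zeros (circle_fun f) (circle_fun q)"
  shows "mutually_separating (circle_fun f) (circle_fun q) (circle_deriv f) (circle_deriv q)"
proof -
  have roots: "DERIV (circle_fun p) x :> circle_deriv p x \<and> circle_deriv p x \<noteq> 0"
    if p: "symmetric_poly p" "simple_unit_roots p" "p \<noteq> 0" and "circle_fun p x = 0" for p x
  proof -
    have 0: "poly p (cis x) = 0" using circle_fun_eq_0_iff[OF p(1)] that by simp
    then have "poly (pderiv p) (cis x) \<noteq> 0" using simple_unit_roots_iff[OF p(3)] p(2) by blast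
    then show ?thesis
      using circle_fun_derivatives(1)[OF p(1) 0] circle_deriv_nonzero[OF p(1) 0] by blast
  qed
  show ?thesis
    using assms roots by unfold_locales (simp_all add: isCont_circle_fun)
qed

text \<open>Separation in both directions upgrades existence of a root in each arc to
  uniqueness.\<close>

lemma roots_separated_if_separates_zeros:
  assumes "symmetric_poly f" "symmetric_poly q" "simple_unit_roots f" "simple_unit_roots q"
    and "f \<noteq> 0" "q \<noteq> 0"
    and sep: "separates_zeros (circle_fun q) (circle_fun f)"
    and "separates_zeros (circle_fun f) (circle_fun q)"
  shows "roots_separated_by f q"
  unfolding roots_separated_by_def
proof (intro allI impI)
  interpret mutually_separating "circle_fun f" "circle_fun q" "circle_deriv f" "circle_deriv q"
    using assms by (rule mutually_separating_circle_fun)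
  fix s t assume "consecutive_roots f s t"
  then have con: "consecutive_zeros (circle_fun f) s t"
    using assms consecutive_roots_iff by blast
  then obtain u where u: "u \<in> {s<..<t}" "circle_fun q u = 0"
    using sep unfolding separates_zeros_def by blast
  have "z = cis u" if "z \<in> open_arc s t" "poly q z = 0" for z
  proof -
    obtain v where v: "v \<in> {s<..<t}" "z = cis v"
      using \<open>z \<in> open_arc s t\<close> by (auto simp: open_arc_def)
    with \<open>poly q z = 0\<close> have "circle_fun q v = 0"
      using assms(2) by (simp add: circle_fun_eq_0_iff)
    then show ?thesis
      using unique_zero_between[OF con _ u(2) v(1) u(1)] v(2) by simp
  qed
  with u assms(2) show "\<exists>!z. z \<in> open_arc s t \<and> poly q z = 0"
    by (intro ex1I[of _ "cis u"]) (auto simp: open_arc_def circle_fun_eq_0_iff)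
qed

section \<open>The form on vectors of powers\<close>

text \<open>The outer variable is \<open>y\<close>, so the constant polynomial \<open>[:y:]\<close>
  is substituted before \<open>x\<close>.\<close>

definition krein_eval :: "complex poly \<Rightarrow> complex poly \<Rightarrow> complex \<Rightarrow> complex \<Rightarrow> complex" where
  "krein_eval g h x y = poly (poly (krein_quotient g h) [:y:]) x"

lemma poly_in_y: "poly (in_y f) [:y:] = [:poly f y:]"
  by (induction f) (auto simp: in_y_def map_poly_pCons)

lemma poly_krein_numerator:
  "poly (krein_numerator g h) [:y:] =
     smult \<i> (smult (poly (conj_poly h) y) g - smult (poly (conj_poly g) y) h)"
  by (simp add: krein_numerator_def poly_in_y in_x_def)

lemma sum_coeff_bivariate:
  fixes P :: "complex poly poly"
  assumes "\<And>k. degree (coeff P k) < n" "degree P < n"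
  shows "(\<Sum>j<n. \<Sum>k<n. coeff (coeff P k) j * x ^ j * y ^ k) = poly (poly P [:y:]) x"
proof -
  have "poly P [:y:] = (\<Sum>k<n. smult (y ^ k) (coeff P k))"
    unfolding poly_altdef[of P] using assms(2)
    by (intro sum.mono_neutral_cong_left) (auto simp: coeff_eq_0 poly_const_pow mult.commute)
  moreover have "poly (coeff P k) x = (\<Sum>j<n. coeff (coeff P k) j * x ^ j)" for k
    unfolding poly_altdef using assms(1)[of k]
    by (intro sum.mono_neutral_cong_left) (auto simp: coeff_eq_0)
  ultimately have "poly (poly P [:y:]) x = (\<Sum>k<n. y ^ k * (\<Sum>j<n. coeff (coeff P k) j * x ^ j))"
    by (simp add: poly_sum)
  also have "\<dots> = (\<Sum>j<n. \<Sum>k<n. coeff (coeff P k) j * x ^ j * y ^ k)"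
    by (subst sum.swap) (simp add: sum_distrib_left ac_simps)
  finally show ?thesis ..
qed

locale symmetric_pair =
  fixes g h :: "complex poly" and n :: nat
  assumes n: "n \<ge> 1" "degree g = n" "degree h = n"
    and sym: "symmetric_poly g" "symmetric_poly h"
begin

lemma nonzero: "g \<noteq> 0" "h \<noteq> 0"
  using n by auto

text \<open>With \<open>y\<close> fixed, \<open>[:1, - y:]\<close> is \<open>1 - x * y\<close> as a
  polynomial in \<open>x\<close>. The identity stays polynomial so that it can be differentiated in
  \<open>x\<close>.\<close>

lemma exact: "[:1, - y:] * poly (krein_quotient g h) [:y:] = poly (krein_numerator g h) [:y:]"
proof -
  have "poly ((1 - var_x * var_y) * krein_quotient g h) [:y:] = poly (krein_numerator g h) [:y:]"
    using krein_quotient_exact[OF sym] n by simp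
  then show ?thesis
    by (simp add: var_x_def var_y_def poly_in_y in_x_def one_pCons)
qed

lemma krein_eval_eq:
  "(1 - x * y) * krein_eval g h x y =
     \<i> * (poly g x * cnj (poly h (cnj y)) - cnj (poly g (cnj y)) * poly h x)"
  using arg_cong[OF exact[of y], of "\<lambda>p. poly p x"]
  by (simp add: krein_eval_def poly_krein_numerator poly_conj_poly algebra_simps)

section \<open>Degree bounds for the quotient\<close>

lemma degree_krein_numerator: "degree (krein_numerator g h) \<le> n"
proof -
  have "degree (in_y (conj_poly f)) \<le> degree f" for f
    unfolding in_y_def using map_poly_degree_leq degree_conj_poly by metis
  from this[of g] this[of h] n show ?thesis
    unfolding krein_numerator_def in_x_def
    by (intro order.trans[OF degree_mult_le] degree_diff_le)
       (auto intro!: order.trans[OF degree_mult_le] degree_diff_le)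
qed

lemma degree_coeff_krein_numerator: "degree (coeff (krein_numerator g h) k) \<le> n"
  using n unfolding krein_numerator_def in_x_def in_y_def
  by (auto simp: coeff_map_poly intro!: degree_diff_le order.trans[OF degree_smult_le])

text \<open>Coefficients of \<open>y ^ Suc k\<close> in the exact division: multiplication by
  \<open>x * y\<close> raises the index in \<open>y\<close> and applies
  \<open>pCons 0\<close>.\<close>

lemma coeff_krein_quotient:
  "coeff (krein_quotient g h) (Suc k) - pCons 0 (coeff (krein_quotient g h) k) =
     coeff (krein_numerator g h) (Suc k)"
proof -
  have "var_x * var_y = monom [:0, 1:] 1"
    by (simp add: var_x_def var_y_def in_x_def in_y_def map_poly_pCons monom_Suc monom_0 one_pCons)
  then have "krein_numerator g h =
      krein_quotient g h - pCons 0 (smult [:0, 1:] (krein_quotient g h))"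
    using krein_quotient_exact[OF sym] n
    by (simp add: left_diff_distrib monom_Suc monom_0)
  then show ?thesis by simp
qed

lemma degree_krein_quotient: "degree (krein_quotient g h) < n"
proof (cases "krein_quotient g h = 0")
  case False
  let ?d = "degree (krein_quotient g h)"
  have "coeff (krein_numerator g h) (Suc ?d) = - pCons 0 (lead_coeff (krein_quotient g h))"
    using coeff_krein_quotient[of ?d] by (simp add: coeff_eq_0)
  with False have "coeff (krein_numerator g h) (Suc ?d) \<noteq> 0" by simp
  then have "Suc ?d \<le> degree (krein_numerator g h)" by (rule le_degree)
  with degree_krein_numerator show ?thesis by linarith
qed (use n in simp)

text \<open>Downward induction on the index in \<open>y\<close>, from the zero coefficient at index
  \<open>n\<close>: \<open>x\<close> times one coefficient is the next one minus a numerator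
  coefficient of degree at most \<open>n\<close>.\<close>

lemma degree_coeff_krein_quotient: "degree (coeff (krein_quotient g h) k) < n"
proof -
  let ?q = "coeff (krein_quotient g h)"
  have step: "degree (?q k) < n" if "degree (?q (Suc k)) < n" for k
  proof -
    have "pCons 0 (?q k) = ?q (Suc k) - coeff (krein_numerator g h) (Suc k)"
      using coeff_krein_quotient[of k] by (simp add: algebra_simps)
    then have "degree (pCons 0 (?q k)) \<le> n"
      using degree_diff_le[of "?q (Suc k)" n] that degree_coeff_krein_numerator by simp
    with n show ?thesis by (cases "?q k = 0") auto
  qed
  have "degree (?q (n - m)) < n" for m
  proof (induction m)
    case 0
    then show ?case using degree_krein_quotient n by (simp add: coeff_eq_0)
  next
    case (Suc m)
    then show ?case using step[of "n - Suc m"] by (cases "m < n") (auto simp: Suc_diff_Suc)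
  qed
  from this[of "n - k"] show ?thesis
    using degree_krein_quotient n by (cases "k \<le> n") (auto simp: coeff_eq_0)
qed

lemma sum_krein_quotient:
  "(\<Sum>j<n. \<Sum>k<n. coeff (coeff (krein_quotient g h) k) j * x ^ j * y ^ k) = krein_eval g h x y"
  unfolding krein_eval_def
  by (rule sum_coeff_bivariate[OF degree_coeff_krein_quotient degree_krein_quotient])

lemma hermitian_form_powers:
  "hermitian_form n (krein_quotient g h) (\<lambda>j. z ^ j) = krein_eval g h z (cnj z)"
  by (simp add: hermitian_form_def flip: sum_krein_quotient)

section \<open>Values of the form at roots of one polynomial\<close>

text \<open>The divisor vanishes at \<open>x = z\<close>, \<open>y = cnj z\<close>, so the value is
  found by differentiating the polynomial identity in \<open>x\<close> at \<open>z\<close>.\<close>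

lemma krein_eval_root:
  assumes "poly g z = 0" "norm z = 1"
  shows "krein_eval g h z (cnj z) = - \<i> * z * poly (pderiv g) z * cnj (poly h z)"
proof -
  have z: "z * cnj z = 1" using complex_norm_square[of z] assms(2) by simp
  let ?P = "poly (krein_quotient g h) [:cnj z:]"
  have "[:1, - cnj z:] * ?P = smult (\<i> * cnj (poly h z)) g"
    using exact[of "cnj z"] assms(1) by (simp only: poly_krein_numerator poly_conj_poly) simp
  then have "poly (pderiv ([:1, - cnj z:] * ?P)) z = \<i> * cnj (poly h z) * poly (pderiv g) z"
    by (simp add: pderiv_smult)
  moreover have "poly (pderiv ([:1, - cnj z:] * ?P)) z = - cnj z * poly ?P z"
    using z by (subst pderiv_mult) (simp add: pderiv_pCons)
  ultimately have "- (z * cnj z) * poly ?P z = z * (\<i> * cnj (poly h z) * poly (pderiv g) z)"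
    by (simp add: mult.assoc)
  with z show ?thesis
    by (simp add: krein_eval_def ac_simps minus_equation_iff[of "poly ?P z"])
qed

text \<open>Equal degrees give \<open>g\<close> and \<open>h\<close> the same half-angle factor,
  which cancels against its conjugate.\<close>

lemma krein_eval_circle_fun:
  assumes "poly g (cis s) = 0"
  shows "krein_eval g h (cis s) (cnj (cis s)) =
    complex_of_real (- (circle_deriv g s * circle_fun h s))"
proof -
  let ?c = "cis (- (real n * s / 2))"
  have c: "?c * cnj ?c = 1" by (simp add: cis_cnj cis_mult)
  have "complex_of_real (circle_deriv g s * circle_fun h s) =
      ?c * (\<i> * cis s * poly (pderiv g) (cis s)) * cnj (?c * poly h (cis s))"
    using circle_fun_derivatives(2)[OF sym(1) assms] of_real_circle_fun[OF sym(2), of s] n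
    by (metis complex_cnj_complex_of_real of_real_mult)
  also have "\<dots> = (?c * cnj ?c) * (\<i> * cis s * poly (pderiv g) (cis s) * cnj (poly h (cis s)))"
    by (simp only: complex_cnj_mult ac_simps)
  also have "\<dots> = - krein_eval g h (cis s) (cnj (cis s))"
    using krein_eval_root[OF assms] by (simp only: c) simp
  finally show ?thesis by simp
qed

lemma krein_eval_distinct_roots:
  assumes "poly g z = 0" "poly g w = 0" "norm w = 1" "z \<noteq> w"
  shows "krein_eval g h z (cnj w) = 0"
proof -
  have "w * cnj w = 1" using complex_norm_square[of w] assms(3) by simp
  then have "1 - z * cnj w \<noteq> 0"
    using assms(4) by (metis eq_iff_diff_eq_0 mult_cancel_right mult_zero_right zero_neq_one)
  with krein_eval_eq[of z "cnj w"] assms show ?thesis by simp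
qed

text \<open>This supplies the continuous function \<open>W\<close> of \<open>constant_sign\<close>.
  Written as a finite sum of powers, the form involves no division.\<close>

lemma isCont_krein_eval: "isCont (\<lambda>\<theta>. Re (krein_eval g h (cis \<theta>) (cnj (cis \<theta>)))) \<theta>"
proof -
  have "continuous_on UNIV (\<lambda>\<theta>. Re (krein_eval g h (cis \<theta>) (cnj (cis \<theta>))))"
    unfolding sum_krein_quotient[symmetric] by (intro continuous_intros)
  then show ?thesis by (simp add: continuous_on_eq_continuous_at)
qed

section \<open>Definiteness and the values at the roots\<close>

text \<open>A vector of powers is nonzero because its first entry is 1. The constant
  \<open>c\<close> is 1 or -1 and treats both kinds of definiteness at once.\<close>

lemma sign_definite_powers:
  assumes "sign_definite n (hermitian_form n (krein_quotient g h))"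
  obtains c :: real where "\<And>z. c * Re (krein_eval g h z (cnj z)) > 0"
proof -
  have nz: "\<exists>j<n. z ^ j \<noteq> 0" for z :: complex
    using n by (intro exI[of _ 0]) auto
  from assms consider "pos_definite n (hermitian_form n (krein_quotient g h))"
    | "neg_definite n (hermitian_form n (krein_quotient g h))"
    by (auto simp: sign_definite_def)
  then show thesis
  proof cases
    case 1
    with nz show thesis
      by (intro that[of 1]) (simp add: pos_definite_def flip: hermitian_form_powers)
  next
    case 2
    with nz show thesis
      by (intro that[of "-1"]) (simp add: neg_definite_def flip: hermitian_form_powers)
  qed
qed

lemma sign_definite_imp_separated:
  assumes "sign_definite n (hermitian_form n (krein_quotient g h))"
  shows "simple_unit_roots g" and "separates_zeros (circle_fun h) (circle_fun g)"
proof -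
  obtain c where c: "\<And>z. c * Re (krein_eval g h z (cnj z)) > 0"
    using sign_definite_powers[OF assms] by blast
  have unit: "norm z = 1" if "poly g z = 0" for z
  proof (rule ccontr)
    assume "norm z \<noteq> 1"
    then have "(cmod z)\<^sup>2 \<noteq> 1"
      using norm_ge_zero[of z] by (auto simp: power2_eq_1_iff simp del: norm_ge_zero)
    then have "1 - z * cnj z \<noteq> 0"
      unfolding complex_norm_square[symmetric] by (metis eq_iff_diff_eq_0 of_real_eq_1_iff)
    with krein_eval_eq[of z "cnj z"] that c[of z] show False by simp
  qed
  have "poly (pderiv g) z \<noteq> 0" if "poly g z = 0" for z
    using krein_eval_root[OF that unit[OF that]] c[of z] by force
  with unit show "simple_unit_roots g"
    using nonzero simple_unit_roots_iff by blast
  show "separates_zeros (circle_fun h) (circle_fun g)"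
  proof (rule separates_zeros_if_constant_sign[where c = "- c"])
    fix s assume "circle_fun g s = 0"
    then have 0: "poly g (cis s) = 0" using circle_fun_eq_0_iff sym by blast
    then show "DERIV (circle_fun g) s :> circle_deriv g s"
      using circle_fun_derivatives sym by blast
    show "- c * (circle_deriv g s * circle_fun h s) > 0"
      using c[of "cis s"] krein_eval_circle_fun[OF 0] by simp
  qed (rule isCont_circle_fun)+
qed

text \<open>Lagrange interpolation at the \<open>n\<close> roots of \<open>g\<close>: apply the linear functional \<open>x\<^sup>j \<mapsto> v j\<close> to
  \<open>x\<^sup>j = (\<Sum>z. z\<^sup>j * L z)\<close>, where the \<open>L z\<close> are the Lagrange basis polynomials.\<close>

lemma obtain_power_coordinates:
  assumes "simple_unit_roots g"
  obtains c where "\<And>j. j < n \<Longrightarrow> v j = (\<Sum>z | poly g z = 0. c z * z ^ j)"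
proof -
  define R where "R = {z. poly g z = 0}"
  have fin: "finite R" unfolding R_def using nonzero poly_roots_finite by blast
  \<comment> \<open>Factorization into distinct linear factors shows that there are exactly
    \<open>n\<close> roots.\<close>
  have "rsquarefree g"
    using assms nonzero by (auto simp: simple_unit_roots_iff rsquarefree_roots)
  then have "smult (lead_coeff g) (\<Prod>z\<in>R. [:- z, 1:]) = g"
    unfolding R_def by (rule complex_poly_decompose_rsquarefree)
  then have "degree g = degree (\<Prod>z\<in>R. [:- z, 1:])"
    using nonzero by (metis degree_smult_eq leading_coeff_0_iff)
  also have "\<dots> = card R" by (subst degree_prod_eq_sum_degree) auto
  finally have card: "card R = n" using n by simp
  define L where "L z = (\<Prod>w\<in>R - {z}. smult (1 / (z - w)) [:- w, 1:])" for z
  have L: "poly (L z) w = (if z = w then 1 else 0)" if "z \<in> R" "w \<in> R" for z w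
  proof (cases "z = w")
    case True
    have "poly (L z) z = 1"
      unfolding L_def poly_prod by (intro prod.neutral) (auto simp: divide_simps)
    with True show ?thesis by simp
  next
    case False
    with that fin show ?thesis
      unfolding L_def poly_prod by (auto simp: prod_zero_iff)
  qed
  have degL: "degree (L z) < n" if "z \<in> R" for z
  proof -
    have "degree (L z) \<le> (\<Sum>w\<in>R - {z}. degree (smult (1 / (z - w)) [:- w, 1:]))"
      unfolding L_def using degree_prod_sum_le[OF finite_Diff[OF fin], unfolded o_def] .
    also have "\<dots> \<le> (\<Sum>w\<in>R - {z}. 1)"
      by (intro sum_mono) (auto intro: order.trans[OF degree_smult_le])
    also have "\<dots> = n - 1" using that fin card by simp
    finally show ?thesis using n by simp
  qed
  have interp: "monom 1 j = (\<Sum>z\<in>R. smult (z ^ j) (L z))" if "j < n" for j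
  proof (rule poly_eqI_degree[of R])
    fix w assume "w \<in> R"
    then have "(\<Sum>z\<in>R. z ^ j * poly (L z) w) = (\<Sum>z\<in>R. if z = w then z ^ j else 0)"
      by (intro sum.cong) (auto simp: L)
    also have "\<dots> = w ^ j" using fin \<open>w \<in> R\<close> by simp
    finally show "poly (monom 1 j) w = poly (\<Sum>z\<in>R. smult (z ^ j) (L z)) w"
      by (simp add: poly_monom poly_sum)
  next
    have "degree (\<Sum>z\<in>R. smult (z ^ j) (L z)) \<le> n - 1"
    proof (rule degree_sum_le[OF fin])
      fix z assume "z \<in> R"
      from degL[OF this] show "degree (smult (z ^ j) (L z)) \<le> n - 1"
        using degree_smult_le[of "z ^ j" "L z"] by linarith
    qed
    then show "degree (\<Sum>z\<in>R. smult (z ^ j) (L z)) < card R" using n card by simp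
  qed (use that card in \<open>simp add: degree_monom_eq\<close>)
  \<comment> \<open>The value of the functional at \<open>L z\<close>.\<close>
  define c where "c z = (\<Sum>k<n. coeff (L z) k * v k)" for z
  show thesis
  proof (rule that[of c])
    fix j assume j: "j < n"
    have "(\<Sum>z\<in>R. c z * z ^ j) = (\<Sum>k<n. (\<Sum>z\<in>R. z ^ j * coeff (L z) k) * v k)"
      unfolding c_def sum_distrib_right by (subst sum.swap) (simp add: ac_simps)
    also have "\<dots> = (\<Sum>k<n. coeff (monom 1 j) k * v k)"
      using interp[OF j] by (simp add: coeff_sum)
    also have "\<dots> = (\<Sum>k<n. if k = j then v k else 0)"
      by (intro sum.cong) auto
    also have "\<dots> = v j" using j by simp
    finally show "v j = (\<Sum>z | poly g z = 0. c z * z ^ j)" by (simp add: R_def)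
  qed
qed

text \<open>Distinct roots of \<open>g\<close> give orthogonal vectors of powers.\<close>

lemma hermitian_form_diagonal:
  assumes "simple_unit_roots g" and v: "\<And>j. j < n \<Longrightarrow> v j = (\<Sum>z | poly g z = 0. c z * z ^ j)"
  shows "hermitian_form n (krein_quotient g h) v =
    (\<Sum>z | poly g z = 0. c z * cnj (c z) * krein_eval g h z (cnj z))"
proof -
  let ?R = "{z. poly g z = 0}" and ?b = "\<lambda>j k. coeff (coeff (krein_quotient g h) k) j"
  have fin: "finite ?R" using nonzero poly_roots_finite by blast
  have "hermitian_form n (krein_quotient g h) v =
      (\<Sum>j<n. \<Sum>k<n. \<Sum>z\<in>?R. \<Sum>w\<in>?R. c z * cnj (c w) * (?b j k * z ^ j * cnj w ^ k))"
    unfolding hermitian_form_def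
    by (intro sum.cong refl) (simp add: v sum_distrib_left sum_distrib_right ac_simps)
  also have "\<dots> = (\<Sum>z\<in>?R. \<Sum>w\<in>?R. \<Sum>j<n. \<Sum>k<n. c z * cnj (c w) * (?b j k * z ^ j * cnj w ^ k))"
    by (simp only: sum.swap[of _ ?R "{..<n}"])
  also have "\<dots> = (\<Sum>z\<in>?R. \<Sum>w\<in>?R. c z * cnj (c w) * krein_eval g h z (cnj w))"
    by (simp add: sum_distrib_left flip: sum_krein_quotient)
  also have "\<dots> = (\<Sum>z\<in>?R. \<Sum>w\<in>?R. if w = z then c z * cnj (c z) * krein_eval g h z (cnj z) else 0)"
    using assms(1) krein_eval_distinct_roots
    by (intro sum.cong refl) (auto simp: simple_unit_roots_def)
  also have "\<dots> = (\<Sum>z\<in>?R. c z * cnj (c z) * krein_eval g h z (cnj z))"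
    using fin by (simp add: sum.delta)
  finally show ?thesis .
qed

text \<open>In the coordinates \<open>c z\<close> the form is the sum of
  \<open>(cmod (c z))\<^sup>2 * W z\<close>, and a nonzero vector has a nonzero coordinate.\<close>

lemma sign_definite_if_constant_sign:
  assumes simple: "simple_unit_roots g"
    and W: "\<And>z. poly g z = 0 \<Longrightarrow> krein_eval g h z (cnj z) = of_real (W z)"
    and sgn: "(\<forall>z. poly g z = 0 \<longrightarrow> W z > 0) \<or> (\<forall>z. poly g z = 0 \<longrightarrow> W z < 0)"
  shows "sign_definite n (hermitian_form n (krein_quotient g h))"
proof -
  let ?R = "{z. poly g z = 0}" and ?F = "hermitian_form n (krein_quotient g h)"
  have fin: "finite ?R" using nonzero poly_roots_finite by blast
  have repr: "\<exists>a. ?F v = complex_of_real (\<Sum>z\<in>?R. a z * W z) \<and> (\<forall>z. a z \<ge> 0) \<and> (\<exists>z\<in>?R. a z > 0)"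
    if nz: "\<exists>j<n. v j \<noteq> 0" for v
  proof -
    obtain c where c: "\<And>j. j < n \<Longrightarrow> v j = (\<Sum>z\<in>?R. c z * z ^ j)"
      using obtain_power_coordinates[OF simple, of v] by blast
    have "?F v = (\<Sum>z\<in>?R. c z * cnj (c z) * krein_eval g h z (cnj z))"
      using simple c by (rule hermitian_form_diagonal)
    also have "\<dots> = complex_of_real (\<Sum>z\<in>?R. (cmod (c z))\<^sup>2 * W z)"
      by (simp add: W flip: complex_norm_square)
    finally have "?F v = complex_of_real (\<Sum>z\<in>?R. (cmod (c z))\<^sup>2 * W z)" .
    moreover have "\<exists>z\<in>?R. (cmod (c z))\<^sup>2 > 0"
    proof (rule ccontr)
      assume "\<not> ?thesis"
      then have "c z = 0" if "z \<in> ?R" for z using that by simp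
      then have "(\<Sum>z\<in>?R. c z * z ^ j) = 0" for j by simp
      with c nz show False by metis
    qed
    ultimately show ?thesis by (intro exI[of _ "\<lambda>z. (cmod (c z))\<^sup>2"]) simp
  qed
  from sgn show ?thesis
  proof
    assume pos: "\<forall>z. poly g z = 0 \<longrightarrow> W z > 0"
    have "?F v \<in> \<real> \<and> Re (?F v) > 0" if nz: "\<exists>j<n. v j \<noteq> 0" for v
    proof -
      obtain a z where a: "?F v = complex_of_real (\<Sum>z\<in>?R. a z * W z)" "\<And>z. a z \<ge> 0"
        and z: "z \<in> ?R" "a z > 0"
        using repr[OF nz] by blast
      have "(\<Sum>z\<in>?R. a z * W z) > 0"
        using z pos a(2) by (intro sum_pos2[OF fin, of z]) (auto intro: mult_nonneg_nonneg less_imp_le)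
      with a(1) show ?thesis by simp
    qed
    then show ?thesis by (simp add: sign_definite_def pos_definite_def)
  next
    assume neg: "\<forall>z. poly g z = 0 \<longrightarrow> W z < 0"
    have "?F v \<in> \<real> \<and> Re (?F v) < 0" if nz: "\<exists>j<n. v j \<noteq> 0" for v
    proof -
      obtain a z where a: "?F v = complex_of_real (\<Sum>z\<in>?R. a z * W z)" "\<And>z. a z \<ge> 0"
        and z: "z \<in> ?R" "a z > 0"
        using repr[OF nz] by blast
      have "(\<Sum>z\<in>?R. a z * - W z) > 0"
        using z neg a(2)
        by (intro sum_pos2[OF fin, of z]) (auto simp: mult_less_0_iff mult_le_0_iff less_imp_le)
      with a(1) show ?thesis by (simp add: sum_negf)
    qed
    then show ?thesis by (simp add: sign_definite_def neg_definite_def)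
  qed
qed

section \<open>Exchange of the two polynomials\<close>

text \<open>The numerator is antisymmetric, and the quotient inherits this because the division is
  exact.\<close>

lemma krein_quotient_swap: "krein_quotient h g = - krein_quotient g h"
proof -
  have "krein_numerator h g = - krein_numerator g h"
    by (simp add: krein_numerator_def algebra_simps)
  moreover have "1 - var_x * var_y dvd krein_numerator g h"
    using krein_quotient_exact[OF sym] n by (metis dvd_triv_left)
  ultimately show ?thesis by (simp add: krein_quotient_def dvd_neg_div)
qed

text \<open>The exchange turns positive into negative definite and conversely, so results about the
  roots of \<open>g\<close> carry over to \<open>h\<close>.\<close>

lemma sign_definite_swap:
  "sign_definite n (hermitian_form n (krein_quotient h g)) \<longleftrightarrow>
   sign_definite n (hermitian_form n (krein_quotient g h))"
proof -
  have "hermitian_form n (krein_quotient h g) v = - hermitian_form n (krein_quotient g h) v" for v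
    by (simp add: krein_quotient_swap hermitian_form_def sum_negf)
  then show ?thesis
    by (auto simp: sign_definite_def pos_definite_def neg_definite_def)
qed

section \<open>From interlacing roots to a definite form\<close>

lemma interlacing_imp_sign_definite:
  assumes "interlacing_roots g h"
  shows "sign_definite n (hermitian_form n (krein_quotient g h))"
proof -
  have simple: "simple_unit_roots g" "simple_unit_roots h"
    and sep: "roots_separated_by g h" "roots_separated_by h g"
    using assms by (auto simp: interlacing_roots_def)
  interpret mutually_separating "circle_fun g" "circle_fun h" "circle_deriv g" "circle_deriv h"
    using simple sym sep nonzero
    by (intro mutually_separating_circle_fun roots_separated_imp_separates_zeros)
  define W where "W z = Re (krein_eval g h z (cnj z))" for z
  \<comment> \<open>For odd \<open>n\<close> a full turn reverses the sign of
    \<open>circle_fun\<close>, but the zero set is always periodic; this provides the later zeros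
    for \<open>no_common_zero\<close>.\<close>
  have period: "circle_fun f (s + 2 * pi) = 0" if "symmetric_poly f" "circle_fun f s = 0" for f s
    using that by (simp add: circle_fun_eq_0_iff flip: cis_mult)
  have common: "circle_fun h s \<noteq> 0" if "circle_fun g s = 0" for s
  proof
    assume 0: "circle_fun h s = 0"
    with no_common_zero[OF that period[OF sym(1) that] period[OF sym(2) 0]] show False by simp
  qed
  have arg: "\<exists>s. z = cis s \<and> circle_fun g s = 0" if "poly g z = 0" for z
  proof -
    have "norm z = 1" using simple that by (simp add: simple_unit_roots_def)
    then have "z = cis (Arg z)" by (metis cis_Arg norm_zero sgn_eq mult_1 div_by_1 of_real_1 zero_neq_one)
    with that show ?thesis using circle_fun_eq_0_iff[OF sym(1)] by metis
  qed
  have W: "krein_eval g h (cis s) (cnj (cis s)) = of_real (W (cis s))"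
    "W (cis s) = - (circle_deriv g s * circle_fun h s)" if "circle_fun g s = 0" for s
    using krein_eval_circle_fun[of s] that sym by (simp_all add: W_def circle_fun_eq_0_iff)
  have same: "W (cis s) * W (cis t) > 0" if "circle_fun g s = 0" "circle_fun g t = 0" for s t
    \<comment> \<open>The minus sign matches the form, which is the negative of
      \<open>circle_deriv g * circle_fun h\<close> at the roots.\<close>
    using constant_sign[of "\<lambda>s. - W (cis s)", OF _ _ common that] W(2) isCont_krein_eval
    by (simp add: W_def)
  have "W z * W w > 0" if "poly g z = 0" "poly g w = 0" for z w
    using arg[OF that(1)] arg[OF that(2)] same by blast
  then have "(\<forall>z. poly g z = 0 \<longrightarrow> W z > 0) \<or> (\<forall>z. poly g z = 0 \<longrightarrow> W z < 0)"
    by (metis zero_less_mult_iff)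
  moreover have "krein_eval g h z (cnj z) = of_real (W z)" if "poly g z = 0" for z
    using arg[OF that] W(1) by blast
  ultimately show ?thesis
    using sign_definite_if_constant_sign[OF simple(1)] by blast
qed

end

theorem theorem4:
  fixes g h :: "complex poly" and n :: nat
  assumes "n \<ge> 1" and "degree g = n" and "degree h = n"
    and "symmetric_poly g" and "symmetric_poly h"
  shows "interlacing_roots g h \<longleftrightarrow> sign_definite n (hermitian_form n (krein_quotient g h))"
proof
  interpret gh: symmetric_pair g h n using assms by unfold_locales
  interpret hg: symmetric_pair h g n using assms by unfold_locales
  {
    assume "interlacing_roots g h"
    then show "sign_definite n (hermitian_form n (krein_quotient g h))"
      by (rule gh.interlacing_imp_sign_definite)
  next
    assume "sign_definite n (hermitian_form n (krein_quotient g h))"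
    \<comment> \<open>Each of the two orders of the pair contributes simple roots for one polynomial
      and one direction of separation.\<close>
    note gh.sign_definite_imp_separated[OF this]
      and hg.sign_definite_imp_separated[OF this[folded gh.sign_definite_swap]]
    then show "interlacing_roots g h"
      unfolding interlacing_roots_def
      by (intro conjI roots_separated_if_separates_zeros gh.sym gh.nonzero)
  }
qed

end
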